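(* Let $r>0$ be real and $n\geq0$ an integer. Then for every complex $y$, \[ w_{n}^{(r)}(y)=\sum_{k=0}^{n}\left\{{n+r\atop k+r}\right\}_{r}(r)_{k}(-1)^{n+k}(y+1)^{k}. \] In particular \[ w_{n}^{(r)}(1)=\sum_{k=0}^{n}\left\{{n+r\atop k+r}\right\}_{r}(r)_{k}(-1)^{n+k}2^{k}. \]
   Context: For real $r>0$ and integer $n\ge0$, $w_{n}^{(r)}(y)=\sum_{k=0}^{n}\left\{{n\atop k}\right\}(r)_{k}\,y^{k}$, where $\left\{{n\atop k}\right\}$ are Stirling numbers of the second kind and $(x)_{k}=x(x+1)\cdots(x+k-1)$, $(x)_0=1$. The $r$-Stirling numbers of the second kind $\left\{{n+r\atop k+r}\right\}_{r}$ (for integers $n,k\ge0$) are defined by $\frac{(e^{t}-1)^{k}e^{rt}}{k!}=\sum_{n\geq k}\left\{{n+r\atop k+r}\right\}_{r}\frac{t^{n}}{n!}$, and are $0$ for $k>n$. *)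

theory Defs
  imports Complex_Main
    "HOL-Combinatorics.Stirling"
    "HOL-Computational_Algebra.Formal_Power_Series"
begin

definition w :: "real \<Rightarrow> nat \<Rightarrow> complex \<Rightarrow> complex" where
  "w r n y = (\<Sum>k\<le>n. of_nat (Stirling n k) * of_real (pochhammer r k) * y ^ k)"

(* rStirling2 r n k is the r-Stirling number {n+r over k+r}_r, for arbitrary real r:
   the arguments n and k are the unshifted ones.  It is n! times the coefficient of t^n in
   (e^t - 1)^k e^(rt) / k!, read as a formal power series in t. *)
definition rStirling2 :: "real \<Rightarrow> nat \<Rightarrow> nat \<Rightarrow> real" where
  "rStirling2 r n k =
     fact n * fps_nth (fps_const (1 / fact k) * (fps_exp 1 - 1) ^ k * fps_exp r) n"

lemma rStirling2_egf:
  "fps_const (1 / fact k) * (fps_exp 1 - 1) ^ k * fps_exp r = Abs_fps (\<lambda>n. rStirling2 r n k / fact n)"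
  by (rule fps_ext) (simp add: rStirling2_def)

lemma rStirling2_eq_0:
  assumes "n < k"
  shows "rStirling2 r n k = 0"
proof -
  have "fps_nth ((fps_exp 1 - 1 :: real fps) ^ k) i = 0" if "i \<le> n" for i
    using that assms startsby_zero_power_prefix[of "fps_exp 1 - 1 :: real fps" k] by simp
  then show ?thesis
    by (simp add: rStirling2_def fps_mult_nth[of _ "fps_exp r"] mult.assoc)
qed

end

(* Both sides satisfy P 0 = 1 and P (n + 1) = y (y + 1) (P n)' + r y P n.  This follows from the
   triangular recurrences of the two families of Stirling numbers: writing z = y + 1, the operator
   y (y + 1) D + r y sends y^k to k y^k + (k + r) y^(k+1) and z^k to (k + r) (z^(k+1) - z^k). *)
theory Submission
  imports Defs
begin

lemma rStirling2_0_left: "rStirling2 r 0 k = (if k = 0 then 1 else 0)"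
  by (cases k) (auto simp: rStirling2_def)

lemma rStirling2_0_right: "rStirling2 r n 0 = r ^ n"
  by (simp add: rStirling2_def)

(* Compare coefficients in the derivative F' = (k + 1 + r) F + G of the exponential generating
   function F = (e^t - 1)^(k+1) e^(rt) / (k+1)!, where G is the one for k. *)
lemma rStirling2_Suc_Suc:
  "rStirling2 r (Suc n) (Suc k) = (real (Suc k) + r) * rStirling2 r n (Suc k) + rStirling2 r n k"
proof -
  define F where "F k = fps_const (1 / fact k) * (fps_exp 1 - 1) ^ k * fps_exp r" for k
  have fact: "fps_const (1 / fact (Suc k)) * fps_const (real (Suc k)) = fps_const (1 / fact k)"
    by (simp add: fact_Suc del: of_nat_Suc)
  have "fps_deriv (F (Suc k)) = fps_const (1 / fact (Suc k)) * fps_const (real (Suc k)) *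
      (fps_exp 1 * (fps_exp 1 - 1) ^ k * fps_exp r) + fps_const r * F (Suc k)"
    unfolding F_def by (simp add: fps_deriv_power algebra_simps del: power_Suc)
  \<comment> \<open>Writing e^t = (e^t - 1) + 1 splits the product into a power \<open>Suc k\<close>
    and a power \<open>k\<close>, the sources of the two terms of the recurrence.\<close>
  also have "fps_exp 1 * (fps_exp 1 - 1) ^ k * fps_exp r
      = (fps_exp 1 - 1) ^ Suc k * fps_exp r + (fps_exp 1 - 1) ^ k * fps_exp r"
    by (simp add: algebra_simps)
  also have "fps_const (1 / fact (Suc k)) * fps_const (real (Suc k)) * \<dots>
      = fps_const (real (Suc k)) * F (Suc k)
        + fps_const (1 / fact (Suc k)) * fps_const (real (Suc k)) * ((fps_exp 1 - 1) ^ k * fps_exp r)"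
    unfolding F_def by (simp only: distrib_left mult_ac)
  also have "\<dots> = fps_const (real (Suc k)) * F (Suc k) + F k"
    unfolding fact F_def by (simp only: mult.assoc)
  finally have "fps_nth (fps_deriv (F (Suc k))) n
      = (real (Suc k) + r) * fps_nth (F (Suc k)) n + fps_nth (F k) n"
    by (simp add: algebra_simps)
  \<comment> \<open>The derivative contributes the factor n + 1, and n! (n + 1) = (n + 1)! is the
    normalisation of row \<open>Suc n\<close>.\<close>
  then have "fact n * (real (Suc n) * fps_nth (F (Suc k)) (Suc n))
      = fact n * ((real (Suc k) + r) * fps_nth (F (Suc k)) n + fps_nth (F k) n)"
    by simp
  moreover have R: "rStirling2 r m j = fact m * fps_nth (F j) m" for m j
    by (simp add: rStirling2_def F_def)
  ultimately show ?thesis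
    unfolding R by (simp add: algebra_simps)
qed

text \<open>Reindexing moves the recurrence from the coefficients to \<open>g\<close>: each
  \<open>A n k\<close> enters row \<open>Suc n\<close> at \<open>k\<close> with weight
  \<open>b k\<close> and at \<open>Suc k\<close> with weight 1. The vanishing of
  \<open>A n (Suc n)\<close> removes the boundary term.\<close>

lemma sum_triangular_recurrence:
  fixes A :: "nat \<Rightarrow> nat \<Rightarrow> 'a::comm_semiring_1"
  assumes "A (Suc n) 0 = b 0 * A n 0"
    and "\<And>k. A (Suc n) (Suc k) = b (Suc k) * A n (Suc k) + A n k"
    and "A n (Suc n) = 0"
  shows "(\<Sum>k\<le>Suc n. A (Suc n) k * g k) = (\<Sum>k\<le>n. A n k * (b k * g k + g (Suc k)))"
proof -
  have "(\<Sum>k\<le>Suc n. A (Suc n) k * g k)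
      = b 0 * A n 0 * g 0 + (\<Sum>k\<le>n. b (Suc k) * A n (Suc k) * g (Suc k)) + (\<Sum>k\<le>n. A n k * g (Suc k))"
    unfolding sum.atMost_Suc_shift assms(1,2)
    by (simp add: distrib_right sum.distrib add.assoc)
  also have "b 0 * A n 0 * g 0 + (\<Sum>k\<le>n. b (Suc k) * A n (Suc k) * g (Suc k))
      = (\<Sum>k\<le>Suc n. b k * A n k * g k)"
    by (simp only: sum.atMost_Suc_shift)
  also have "\<dots> = (\<Sum>k\<le>n. b k * A n k * g k)"
    using assms(3) by simp
  finally show ?thesis
    by (simp add: distrib_left sum.distrib mult_ac)
qed

text \<open>Restores the exponent in the terms of a derivative; at \<open>k = 0\<close>, where the
  subtraction truncates, the factor \<open>of_nat k\<close> is zero.\<close>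

lemma mult_power_pred: "x * (of_nat k * x ^ (k - Suc 0)) = of_nat k * x ^ k"
  for x :: "'a::comm_semiring_1"
  by (cases k) (simp_all add: mult_ac)

text \<open>Keeping \<open>d\<close> a variable lets one derivative value serve both polynomials in
  the final induction.\<close>

lemma w_Suc:
  assumes "(w r n has_field_derivative d) (at y)"
  shows "w r (Suc n) y = y * (y + 1) * d + of_real r * y * w r n y"
proof -
  let ?c = "\<lambda>k. of_nat (Stirling n k) * of_real (pochhammer r k) :: complex"
  have "(w r n has_field_derivative (\<Sum>k\<le>n. ?c k * (of_nat k * y ^ (k - Suc 0)))) (at y)"
    unfolding w_def[abs_def] by (auto intro!: derivative_eq_intros sum.cong)
  with assms have d: "d = (\<Sum>k\<le>n. ?c k * (of_nat k * y ^ (k - Suc 0)))"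
    by (rule DERIV_unique)
  have yd: "y * d = (\<Sum>k\<le>n. ?c k * (of_nat k * y ^ k))"
    unfolding d sum_distrib_left by (intro sum.cong refl) (metis mult.left_commute mult_power_pred)
  have "w r (Suc n) y = (\<Sum>k\<le>n. of_nat (Stirling n k) *
      (of_nat k * (of_real (pochhammer r k) * y ^ k) + of_real (pochhammer r (Suc k)) * y ^ Suc k))"
    unfolding w_def mult.assoc
    by (rule sum_triangular_recurrence[where A = "\<lambda>n k. of_nat (Stirling n k)"]) (cases n, simp_all add: algebra_simps)
  \<comment> \<open>Since (r)_(k+1) = (r)_k (r + k), this is termwise k y^k + (r + k) y^(k+1) = (y +
    1) k y^k + r y y^k.\<close>
  also have "\<dots> = (y + 1) * (y * d) + of_real r * y * w r n y"
    unfolding yd w_def sum_distrib_left sum.distrib[symmetric]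
    by (intro sum.cong refl) (simp add: pochhammer_Suc algebra_simps)
  finally show ?thesis
    by (simp add: mult_ac)
qed

text \<open>The right-hand side of the claim as a function of \<open>y\<close>, so that it can be
  differentiated.\<close>

definition w_shifted :: "real \<Rightarrow> nat \<Rightarrow> complex \<Rightarrow> complex" where
  "w_shifted r n y =
     (\<Sum>k\<le>n. of_real (rStirling2 r n k) * of_real (pochhammer r k) * (-1) ^ (n + k) * (y + 1) ^ k)"

lemma w_shifted_Suc:
  assumes "(w_shifted r n has_field_derivative d) (at y)"
  shows "w_shifted r (Suc n) y = y * (y + 1) * d + of_real r * y * w_shifted r n y"
proof -
  let ?c = "\<lambda>k. of_real (rStirling2 r n k) * of_real (pochhammer r k) * (-1) ^ (n + k) :: complex"
  have "(w_shifted r n has_field_derivative (\<Sum>k\<le>n. ?c k * (of_nat k * (y + 1) ^ (k - Suc 0)))) (at y)"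
    unfolding w_shifted_def[abs_def] by (auto intro!: derivative_eq_intros sum.cong)
  with assms have d: "d = (\<Sum>k\<le>n. ?c k * (of_nat k * (y + 1) ^ (k - Suc 0)))"
    by (rule DERIV_unique)
  have yd: "(y + 1) * d = (\<Sum>k\<le>n. ?c k * (of_nat k * (y + 1) ^ k))"
    unfolding d sum_distrib_left by (intro sum.cong refl) (metis mult.left_commute mult_power_pred)
  \<comment> \<open>Here \<open>b k\<close> is k + r, and \<open>g k\<close> carries the sign with
    the new row index \<open>Suc n\<close> held fixed.\<close>
  have "w_shifted r (Suc n) y = (\<Sum>k\<le>n. of_real (rStirling2 r n k) *
      (of_real (real k + r) * (of_real (pochhammer r k) * ((-1) ^ (Suc n + k) * (y + 1) ^ k))
       + of_real (pochhammer r (Suc k)) * ((-1) ^ (Suc n + Suc k) * (y + 1) ^ Suc k)))"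
    unfolding w_shifted_def mult.assoc
    by (rule sum_triangular_recurrence[where A = "\<lambda>n k. of_real (rStirling2 r n k)"])
       (simp_all add: rStirling2_0_right rStirling2_Suc_Suc rStirling2_eq_0)
  \<comment> \<open>The two terms have opposite signs and combine to a multiple of (k + r) (z^(k+1)
    - z^k) = (k + r) y z^k, with z = y + 1.\<close>
  also have "\<dots> = y * ((y + 1) * d) + of_real r * y * w_shifted r n y"
    unfolding yd w_shifted_def sum_distrib_left sum.distrib[symmetric]
    by (intro sum.cong refl) (simp add: pochhammer_Suc algebra_simps)
  finally show ?thesis
    by (simp add: mult_ac)
qed

text \<open>The induction is on equality of functions, because equality at a single point would not
  carry the derivative over.\<close>

lemma w_eq_w_shifted: "w r n = w_shifted r n"
proof (induction n)
  case 0
  then show ?case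
    by (simp add: fun_eq_iff w_def w_shifted_def rStirling2_0_left)
next
  case (Suc n)
  have "w r (Suc n) y = w_shifted r (Suc n) y" for y
  proof -
    have "\<exists>d. (w r n has_field_derivative d) (at y)"
      unfolding w_def[abs_def] by (rule exI) (auto intro!: derivative_eq_intros)
    then obtain d where "(w r n has_field_derivative d) (at y)" ..
    with Suc show ?thesis
      using w_Suc w_shifted_Suc by metis
  qed
  then show ?case ..
qed

theorem theorem3p3:
  fixes r :: real and n :: nat
  assumes "r > 0"
  shows "(\<forall>y::complex. w r n y =
            (\<Sum>k\<le>n. of_real (rStirling2 r n k) * of_real (pochhammer r k) * (-1) ^ (n + k) * (y + 1) ^ k))
       \<and> w r n 1 =
            (\<Sum>k\<le>n. of_real (rStirling2 r n k) * of_real (pochhammer r k) * (-1) ^ (n + k) * 2 ^ k)"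
  by (simp add: w_eq_w_shifted w_shifted_def)

end
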